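(* For $j=1,\ldots,4$ let $f^j=(f_{1j},\ldots,f_{n_jj})'$ be a balanced column with $q_j\ge 2$ levels $\{0,\ldots,q_j-1\}$ and induced matrix $X_j=(x^j_{st})$, and suppose $n_1=n_3$ and $n_2=n_4$. (a) Suppose $q_1=q_2=q_3=q_4=q$ and let $\mathcal{A}=\{0,\ldots,q-1\}$ be equipped with an Abelian group operation $+_{\mathcal{A}}$. Then: (i) $f^1$ and $f^3$ are fully aliased if and only if $X_1X_1'=X_3X_3'$; (ii) the induced matrix of $f^1\oplus_{\mathcal{A}}f^2$ is $[(X_2P_{f_{11}})',\ldots,(X_2P_{f_{n_11}})']'=(X_1\otimes X_2)P$, where $P=(P_0',\ldots,P_{q-1}')'$ and $P_i$ is the $q\times q$ permutation matrix defined by $i+_{\mathcal{A}}(0,\ldots,q-1)=(0,\ldots,q-1)P_i'$, $i=0,\ldots,q-1$; (iii) if $f^1\oplus_{\mathcal{A}}f^2$ and $f^3\oplus_{\mathcal{A}}f^4$ are fully aliased, then $f^1$ is fully aliased with $f^3$ and $f^2$ is fully aliased with $f^4$. (b) For general $q_1,\ldots,q_4$: (i) the induced matrix of the $q_1q_2$-level column $q_2\left(f^1-\frac{q_1-1}{2}\right)\oplus\left(f^2-\frac{q_2-1}{2}\right)+\frac{q_1q_2-1}{2}$ is $X_1\otimes X_2$; (ii) the columns $q_2\left(f^1-\frac{q_1-1}{2}\right)\oplus\left(f^2-\frac{q_2-1}{2}\right)+\frac{q_1q_2-1}{2}$ and $q_4\left(f^3-\frac{q_3-1}{2}\right)\oplus\left(f^4-\frac{q_4-1}{2}\right)+\frac{q_3q_4-1}{2}$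 are fully aliased if and only if $f^1$ is fully aliased with $f^3$ and $f^2$ is fully aliased with $f^4$; (iii) if $q_3=q_4=q$ and $\mathcal{A}=\{0,\ldots,q-1\}$ carries an Abelian group operation $+_{\mathcal{A}}$, then $q_2\left(f^1-\frac{q_1-1}{2}\right)\oplus\left(f^2-\frac{q_2-1}{2}\right)+\frac{q_1q_2-1}{2}$ and $f^3\oplus_{\mathcal{A}}f^4$ are never fully aliased.
   Context: Prime denotes transpose. A column with $q$ levels is a vector with entries in $\{0,\ldots,q-1\}$; it is balanced if each of the $q$ symbols occurs equally often. The induced matrix of a $q$-level column $f=(f_1,\ldots,f_n)'$ is the $n\times q$ $0/1$ matrix $X=(x_{st})$ with $x_{st}=1$ if $f_s=t-1$ and $x_{st}=0$ otherwise. Two columns of equal length are fully aliased if one can be obtained from the other by permuting the levels (so they have the same number of levels, and columns with different numbers of levels are never fully aliased). For a scalar $a$ and a matrix $B$, $a+B$ is the matrix obtained by adding $a$ to every entry. For $A=(a_{ij})$ of order $r\times s$ and $B$ of order $u\times v$, the Kronecker sum $A\oplus B$ is the $ru\times sv$ block matrix whose $(i,j)$ block is $a_{ij}+B$, and the Kronecker product $A\otimes B$ is the block matrix whose $(i,j)$ block is $a_{ij}B$. $\oplus$ uses ordinary real addition, while $\oplus_{\mathcal{A}}$ is the Kronecker sum with addition $+_{\mathcal{A}}$ of the group $\mathcal{A}$. In $(0,\ldots,q-1)P_i'$ the product is ordinary matrix multiplication over the reals. In $q_2(f^1-\frac{q_1-1}{2})\oplus(\cdot)+c$, the multiplication by $q_2$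 applies to $f^1-\frac{q_1-1}{2}$ before the Kronecker sum, and the constant $c$ is added to every entry at the end. *)

theory Defs
  imports "Jordan_Normal_Form.Matrix" "HOL-Algebra.Group" "HOL-Combinatorics.Permutations"
begin

no_notation mult (infixl \<open>\<otimes>\<index>\<close> 70)

text \<open>Columns are real matrices with a single column, and rows and columns of a matrix are indexed
  from 0.  The number of levels is not determined by the entries of a column alone, so it is an
  explicit argument of the notions below.\<close>

definition levels :: "nat \<Rightarrow> real set" where
  "levels q = real ` {0..<q}"

definition is_column :: "nat \<Rightarrow> nat \<Rightarrow> real mat \<Rightarrow> bool" where
  "is_column n q f \<longleftrightarrow> f \<in> carrier_mat n 1 \<and> (\<forall>s<n. f $$ (s, 0) \<in> levels q)"

definition balanced :: "nat \<Rightarrow> real mat \<Rightarrow> bool" where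
  "balanced q f \<longleftrightarrow> (\<forall>a\<in>levels q. \<forall>b\<in>levels q.
     card {s. s < dim_row f \<and> f $$ (s, 0) = a} = card {s. s < dim_row f \<and> f $$ (s, 0) = b})"

text \<open>With \<open>t\<close> counted from 0, the condition \<open>f\<^sub>s = t - 1\<close> becomes \<open>f\<^sub>s = t\<close>.\<close>

definition induced_mat :: "nat \<Rightarrow> real mat \<Rightarrow> real mat" where
  "induced_mat q f = mat (dim_row f) q (\<lambda>(s, t). if f $$ (s, 0) = real t then 1 else 0)"

definition fully_aliased :: "nat \<Rightarrow> real mat \<Rightarrow> nat \<Rightarrow> real mat \<Rightarrow> bool" where
  "fully_aliased q f q' g \<longleftrightarrow> q = q' \<and> (\<exists>\<pi>. \<pi> permutes levels q \<and> g = map_mat \<pi> f)"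

text \<open>The block matrix whose \<open>(i,j)\<close> block is obtained by applying \<open>h (A $$ (i, j))\<close> to all
  entries of \<open>B\<close>.\<close>

definition kron :: "('a \<Rightarrow> 'b \<Rightarrow> 'c) \<Rightarrow> 'a mat \<Rightarrow> 'b mat \<Rightarrow> 'c mat" where
  "kron h A B = mat (dim_row A * dim_row B) (dim_col A * dim_col B)
     (\<lambda>(i, j). h (A $$ (i div dim_row B, j div dim_col B)) (B $$ (i mod dim_row B, j mod dim_col B)))"

definition kron_prod :: "real mat \<Rightarrow> real mat \<Rightarrow> real mat" (infixl \<open>\<otimes>\<^sub>K\<close> 70) where
  "A \<otimes>\<^sub>K B = kron (*) A B"

definition kron_sum :: "real mat \<Rightarrow> real mat \<Rightarrow> real mat" (infixl \<open>\<oplus>\<^sub>K\<close> 65) where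
  "A \<oplus>\<^sub>K B = kron (+) A B"

definition group_kron_sum :: "real monoid \<Rightarrow> real mat \<Rightarrow> real mat \<Rightarrow> real mat" where
  "group_kron_sum G A B = kron (mult G) A B"

definition scalar_add :: "real \<Rightarrow> real mat \<Rightarrow> real mat" where
  "scalar_add a B = map_mat ((+) a) B"

definition combined_column :: "nat \<Rightarrow> real mat \<Rightarrow> nat \<Rightarrow> real mat \<Rightarrow> real mat" where
  "combined_column q f r g =
     scalar_add ((real q * real r - 1) / 2)
       ((real r \<cdot>\<^sub>m scalar_add (- ((real q - 1) / 2)) f) \<oplus>\<^sub>K scalar_add (- ((real r - 1) / 2)) g)"

text \<open>This is \<open>[M\<^sub>1', \<dots>, M\<^sub>r']'\<close> for matrices with \<open>c\<close> columns.\<close>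

definition stack_rows :: "nat \<Rightarrow> real mat list \<Rightarrow> real mat" where
  "stack_rows c Ms = foldr (@\<^sub>r) Ms (0\<^sub>m 0 c)"

definition permutation_mat :: "nat \<Rightarrow> real mat \<Rightarrow> bool" where
  "permutation_mat q P \<longleftrightarrow>
     (\<exists>p. p permutes {0..<q} \<and> P = mat q q (\<lambda>(i, j). if j = p i then 1 else 0))"

definition level_row :: "nat \<Rightarrow> real mat" where
  "level_row q = mat 1 q (\<lambda>(i, j). real j)"

text \<open>The description is well defined by \<open>shift_mat_ex1\<close> below.\<close>

definition shift_mat :: "real monoid \<Rightarrow> nat \<Rightarrow> real \<Rightarrow> real mat" where
  "shift_mat G q i = (THE P. permutation_mat q P \<and>
     map_mat (mult G i) (level_row q) = level_row q * transpose_mat P)"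

lemma level_row_mult_perm:
  assumes "p permutes {0..<q}"
  shows "level_row q * transpose_mat (mat q q (\<lambda>(i, j). if j = p i then 1 else 0))
    = mat 1 q (\<lambda>(i, j). real (p j))"
proof (rule eq_matI)
  fix i j assume ij: "i < dim_row (mat 1 q (\<lambda>(i, j). real (p j)))"
    "j < dim_col (mat 1 q (\<lambda>(i, j). real (p j)))"
  have "p j \<in> {0..<q}" using permutes_in_image[OF assms, of j] ij by simp
  then have "(\<Sum>k = 0..<q. real k * (if k = p j then 1 else 0)) = real (p j)"
    by (simp add: if_distrib[of "(*) _"] cong: if_cong)
  with ij show "(level_row q * transpose_mat (mat q q (\<lambda>(i, j). if j = p i then 1 else 0))) $$ (i, j)
      = mat 1 q (\<lambda>(i, j). real (p j)) $$ (i, j)"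
    by (simp add: level_row_def scalar_prod_def if_distrib cong: if_cong)
qed (auto simp: level_row_def)

lemma shift_mat_ex1:
  assumes G: "comm_group G" and c: "carrier G = levels q" and i: "i \<in> levels q"
  shows "\<exists>!P. permutation_mat q P \<and>
    map_mat (mult G i) (level_row q) = level_row q * transpose_mat P"
proof -
  interpret comm_group G by fact
  define p where "p k = (if k < q then nat \<lfloor>mult G i (real k)\<rfloor> else k)" for k
  have rp: "mult G i (real k) \<in> levels q" if "k < q" for k
    using that i c m_closed[of i "real k"] by (auto simp: levels_def)
  have rp': "real (p k) = mult G i (real k)" and pq: "p k < q" if "k < q" for k
    using rp[OF that] that by (auto simp: p_def levels_def)
  have "inj_on p {0..<q}"
  proof (rule inj_onI)
    fix x y assume xy: "x \<in> {0..<q}" "y \<in> {0..<q}" "p x = p y"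
    then have "mult G i (real x) = mult G i (real y)" using rp'[of x] rp'[of y] by simp
    moreover have "real x \<in> carrier G" "real y \<in> carrier G" using xy c by (auto simp: levels_def)
    ultimately show "x = y" using i c by simp
  qed
  moreover have "p ` {0..<q} \<subseteq> {0..<q}" using pq by auto
  ultimately have "bij_betw p {0..<q} {0..<q}"
    by (simp add: bij_betw_def endo_inj_surj)
  then have perm: "p permutes {0..<q}" by (rule bij_imp_permutes) (simp add: p_def)
  have row: "map_mat (mult G i) (level_row q) = mat 1 q (\<lambda>(i, j). real (p j))"
    by (rule eq_matI) (auto simp: level_row_def rp')
  show ?thesis
  proof (rule ex1I)
    show "permutation_mat q (mat q q (\<lambda>(i, j). if j = p i then 1 else 0)) \<and>
      map_mat (mult G i) (level_row q)
        = level_row q * transpose_mat (mat q q (\<lambda>(i, j). if j = p i then 1 else 0))"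
      using perm row level_row_mult_perm[OF perm] by (auto simp: permutation_mat_def)
  next
    fix P assume P: "permutation_mat q P \<and>
      map_mat (mult G i) (level_row q) = level_row q * transpose_mat P"
    then obtain r where r: "r permutes {0..<q}"
      and Pr: "P = mat q q (\<lambda>(i, j). if j = r i then 1 else 0)"
      by (auto simp: permutation_mat_def)
    have eq: "mat 1 q (\<lambda>(i, j). real (r j)) = mat 1 q (\<lambda>(i, j). real (p j))"
      using P row level_row_mult_perm[OF r] Pr by simp
    have "r k = p k" if "k < q" for k
      using arg_cong[OF eq, of "\<lambda>M. M $$ (0, k)"] that by simp
    then show "P = mat q q (\<lambda>(i, j). if j = p i then 1 else 0)"
      unfolding Pr by (intro eq_matI) auto
  qed
qed

lemma is_column_group_kron_sum:
  assumes "comm_group G" "carrier G = levels q" "is_column m q f" "is_column n q g"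
  shows "is_column (m * n) q (group_kron_sum G f g)"
proof -
  interpret comm_group G by fact
  have "n > 0" if "s < m * n" for s using that by (cases n) auto
  then show ?thesis using assms(2-4) m_closed
    by (auto simp: is_column_def group_kron_sum_def kron_def less_mult_imp_div_less)
qed

end

theory Submission
  imports Defs
begin

text \<open>A column is determined up to full aliasing by its partition of the rows into sets of equal
  entries.  Both Kronecker constructions apply an operation that is cancellative in each argument,
  so restricting to rows that share one coordinate recovers the partitions of the factors, and the
  number of levels of a balanced factor is the number of parts.  In (b)(iii) this would give
  \<open>q\<^sub>1 = q\<^sub>2 = q = q\<^sub>1 q\<^sub>2\<close>, which is impossible.\<close>

section \<open>Full aliasing as equality of row partitions\<close>

text \<open>The numbers of levels do not enter, so columns with different numbers of levels can be
  compared as well.\<close>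

definition same_partition :: "nat \<Rightarrow> real mat \<Rightarrow> real mat \<Rightarrow> bool" where
  "same_partition n f g \<longleftrightarrow>
     (\<forall>s<n. \<forall>t<n. f $$ (s, 0) = f $$ (t, 0) \<longleftrightarrow> g $$ (s, 0) = g $$ (t, 0))"

lemma columnD:
  assumes "is_column n q f"
  shows "dim_row f = n" "dim_col f = 1" "s < n \<Longrightarrow> f $$ (s, 0) \<in> levels q"
  using assms by (auto simp: is_column_def)

lemma column_entry:
  assumes "is_column n q f" "s < n"
  obtains a where "a < q" "f $$ (s, 0) = real a"
  using columnD(3)[OF assms] by (auto simp: levels_def)

lemma finite_levels [simp]: "finite (levels q)"
  by (simp add: levels_def)

lemma card_levels [simp]: "card (levels q) = q"
  by (simp add: levels_def card_image)

text \<open>The symbol in row 0 occurs, and equal frequencies then force every symbol to occur. An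
  empty column would satisfy \<open>balanced\<close> vacuously without attaining any level.\<close>

lemma balanced_onto:
  assumes f: "is_column n q f" and b: "balanced q f" and n: "n \<ge> 1"
  shows "(\<lambda>s. f $$ (s, 0)) ` {..<n} = levels q"
proof
  show "(\<lambda>s. f $$ (s, 0)) ` {..<n} \<subseteq> levels q"
    using columnD(3)[OF f] by auto
  show "levels q \<subseteq> (\<lambda>s. f $$ (s, 0)) ` {..<n}"
  proof
    fix a assume a: "a \<in> levels q"
    have "f $$ (0, 0) \<in> levels q" using columnD(3)[OF f] n by simp
    with a b have "card {s. s < dim_row f \<and> f $$ (s, 0) = a}
        = card {s. s < dim_row f \<and> f $$ (s, 0) = f $$ (0, 0)}"
      unfolding balanced_def by blast
    moreover have "0 \<in> {s. s < dim_row f \<and> f $$ (s, 0) = f $$ (0, 0)}"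
      using n columnD(1)[OF f] by simp
    then have "card {s. s < dim_row f \<and> f $$ (s, 0) = f $$ (0, 0)} > 0"
      by (subst card_gt_0_iff) auto
    ultimately have "{s. s < dim_row f \<and> f $$ (s, 0) = a} \<noteq> {}"
      by (metis card.empty less_irrefl)
    then show "a \<in> (\<lambda>s. f $$ (s, 0)) ` {..<n}"
      using columnD(1)[OF f] by auto
  qed
qed

lemma fully_aliased_same_partition:
  assumes f: "is_column n q f" and fa: "fully_aliased q f q' g"
  shows "same_partition n f g"
proof -
  obtain \<pi> where p: "\<pi> permutes levels q" and g: "g = map_mat \<pi> f"
    using fa by (auto simp: fully_aliased_def)
  show ?thesis
    using columnD[OF f] permutes_inj[OF p] by (auto simp: same_partition_def g inj_def)
qed

text \<open>One direction of the equivalence in \<open>same_partition\<close> makes the induced map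
  on levels well defined, the other makes it injective. Since \<open>q'\<close> may differ from
  \<open>q\<close>, the map serves both to build a permutation and to compare numbers of
  levels.\<close>

lemma same_partition_map:
  assumes f: "is_column n q f" and onto: "(\<lambda>s. f $$ (s, 0)) ` {..<n} = levels q"
    and g: "is_column n q' g" and k: "same_partition n f g"
  obtains h where "inj_on h (levels q)" "h ` levels q \<subseteq> levels q'"
    "\<And>s. s < n \<Longrightarrow> g $$ (s, 0) = h (f $$ (s, 0))"
proof
  \<comment> \<open>Every level has a row because \<open>f\<close> is onto; \<open>inv_into\<close>
    picks one, and \<open>same_partition\<close> makes the value of \<open>g\<close> there
    independent of the choice.\<close>
  define h where "h x = g $$ (inv_into {..<n} (\<lambda>s. f $$ (s, 0)) x, 0)" for x
  have i: "inv_into {..<n} (\<lambda>s. f $$ (s, 0)) x < n"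
      "f $$ (inv_into {..<n} (\<lambda>s. f $$ (s, 0)) x, 0) = x" if "x \<in> levels q" for x
    using inv_into_into[of x "\<lambda>s. f $$ (s, 0)" "{..<n}"]
      f_inv_into_f[of x "\<lambda>s. f $$ (s, 0)" "{..<n}"] that onto by auto
  show "inj_on h (levels q)"
  proof (rule inj_onI)
    fix x y assume xy: "x \<in> levels q" "y \<in> levels q" "h x = h y"
    then show "x = y"
      using k[unfolded same_partition_def, rule_format, OF i(1)[OF xy(1)] i(1)[OF xy(2)]]
      by (simp add: h_def i)
  qed
  show "h ` levels q \<subseteq> levels q'"
    using i columnD(3)[OF g] by (auto simp: h_def)
  show "g $$ (s, 0) = h (f $$ (s, 0))" if "s < n" for s
    using i(2)[OF columnD(3)[OF f that]]
      k[unfolded same_partition_def, rule_format, OF i(1)[OF columnD(3)[OF f that]] that]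
    by (simp add: h_def)
qed

text \<open>An injective self-map of the finite set \<open>levels q\<close> is bijective, so the
  induced map on levels is already a permutation.\<close>

lemma same_partition_fully_aliased:
  assumes f: "is_column n q f" and onto: "(\<lambda>s. f $$ (s, 0)) ` {..<n} = levels q"
    and g: "is_column n q g" and k: "same_partition n f g"
  shows "fully_aliased q f q g"
proof -
  obtain h where h: "inj_on h (levels q)" "h ` levels q \<subseteq> levels q"
    "\<And>s. s < n \<Longrightarrow> g $$ (s, 0) = h (f $$ (s, 0))"
    using same_partition_map[OF assms] by blast
  \<comment> \<open>\<open>permutes\<close> demands the identity outside \<open>levels q\<close>,
    where \<open>h\<close> is arbitrary.\<close>
  define \<pi> where "\<pi> x = (if x \<in> levels q then h x else x)" for x
  have "bij_betw h (levels q) (levels q)"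
    using h by (simp add: bij_betw_def endo_inj_surj)
  then have "bij_betw \<pi> (levels q) (levels q)"
    by (rule iffD1[OF bij_betw_cong, rotated]) (simp add: \<pi>_def)
  then have "\<pi> permutes levels q" by (rule bij_imp_permutes) (simp add: \<pi>_def)
  moreover have "g = map_mat \<pi> f"
    using columnD[OF f] columnD[OF g] h(3) by (intro eq_matI) (auto simp: \<pi>_def)
  ultimately show ?thesis by (auto simp: fully_aliased_def)
qed

lemma same_partition_levels_le:
  assumes "is_column n q f" "(\<lambda>s. f $$ (s, 0)) ` {..<n} = levels q"
    and "is_column n q' g" "same_partition n f g"
  shows "q \<le> q'"
proof -
  obtain h where "inj_on h (levels q)" "h ` levels q \<subseteq> levels q'"
    using same_partition_map[OF assms] by metis
  from card_inj_on_le[OF this] show ?thesis by simp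
qed

lemma same_partition_sym: "same_partition n f g \<Longrightarrow> same_partition n g f"
  by (simp add: same_partition_def)

text \<open>Each column attains all its levels, so the injections between the level sets exist in
  both directions.\<close>

lemma same_partition_levels_eq:
  assumes "is_column n q f" "(\<lambda>s. f $$ (s, 0)) ` {..<n} = levels q"
    and "is_column n q' g" "(\<lambda>s. g $$ (s, 0)) ` {..<n} = levels q'"
    and "same_partition n f g"
  shows "q = q'"
  using same_partition_levels_le same_partition_sym assms by (metis antisym)

section \<open>Kronecker constructions with cancellative operations\<close>

text \<open>Splits an index into a block number and a position inside the block. It is applied to
  rows of Kronecker constructions and also to levels, which combined columns number in the same
  way.\<close>

lemma pair_index:
  fixes m n s :: nat
  assumes "s < m * n"
  obtains i j where "i < m" "j < n" "s = i * n + j"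
proof
  have "n > 0" using assms by (cases n) auto
  show "s div n < m" using assms by (simp add: less_mult_imp_div_less)
  show "s mod n < n" using \<open>n > 0\<close> by simp
qed simp

lemma pair_index_less:
  fixes i j m n :: nat
  assumes "i < m" "j < n"
  shows "i * n + j < m * n"
proof -
  have "i * n + j < Suc i * n" using assms by simp
  also have "\<dots> \<le> m * n" using assms by (intro mult_le_mono1) simp
  finally show ?thesis .
qed

lemma index_kron_column:
  assumes "is_column m q f" "is_column n r g" "i < m" "j < n"
  shows "kron h f g $$ (i * n + j, 0) = h (f $$ (i, 0)) (g $$ (j, 0))"
  using assms columnD[OF assms(1)] columnD[OF assms(2)] pair_index_less[OF assms(3,4)]
  by (simp add: kron_def)

text \<open>Rows that share one coordinate differ only in the other argument of the operation, and
  cancellation strips the shared one. The operations \<open>h\<close> and \<open>h'\<close> may be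
  different, which allows a combined column to be compared with a group sum.\<close>

lemma kron_same_partition_factors:
  assumes cols: "is_column m q f" "is_column n r g" "is_column m q' f'" "is_column n r' g'"
    and pos: "m \<ge> 1" "n \<ge> 1"
    and k: "same_partition (m * n) (kron h f g) (kron h' f' g')"
    and h: "\<And>b. b \<in> levels r \<Longrightarrow> inj_on (\<lambda>a. h a b) (levels q)"
      "\<And>a. a \<in> levels q \<Longrightarrow> inj_on (h a) (levels r)"
    and h': "\<And>b. b \<in> levels r' \<Longrightarrow> inj_on (\<lambda>a. h' a b) (levels q')"
      "\<And>a. a \<in> levels q' \<Longrightarrow> inj_on (h' a) (levels r')"
  shows "same_partition m f f'" "same_partition n g g'"
proof -
  have eq: "h (f $$ (i, 0)) (g $$ (j, 0)) = h (f $$ (i', 0)) (g $$ (j', 0)) \<longleftrightarrow>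
      h' (f' $$ (i, 0)) (g' $$ (j, 0)) = h' (f' $$ (i', 0)) (g' $$ (j', 0))"
    if "i < m" "j < n" "i' < m" "j' < n" for i j i' j'
    using k[unfolded same_partition_def, rule_format, of "i * n + j" "i' * n + j'"] that
    by (simp add: pair_index_less index_kron_column[OF cols(1,2)] index_kron_column[OF cols(3,4)])
  note mem = columnD(3)[OF cols(1)] columnD(3)[OF cols(2)]
    columnD(3)[OF cols(3)] columnD(3)[OF cols(4)]
  show "same_partition m f f'" unfolding same_partition_def
  proof (intro allI impI)
    fix s t assume st: "s < m" "t < m"
    show "f $$ (s, 0) = f $$ (t, 0) \<longleftrightarrow> f' $$ (s, 0) = f' $$ (t, 0)"
      \<comment> \<open>Both rows have second coordinate 0, which exists because
        \<open>n \<ge> 1\<close>.\<close>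
      using eq[of s 0 t 0] st pos mem(1)[of s] mem(1)[of t] mem(3)[of s] mem(3)[of t]
        inj_on_eq_iff[OF h(1)[OF mem(2)[of 0]]] inj_on_eq_iff[OF h'(1)[OF mem(4)[of 0]]]
      by simp
  qed
  show "same_partition n g g'" unfolding same_partition_def
  proof (intro allI impI)
    fix s t assume st: "s < n" "t < n"
    show "g $$ (s, 0) = g $$ (t, 0) \<longleftrightarrow> g' $$ (s, 0) = g' $$ (t, 0)"
      using eq[of 0 s 0 t] st pos mem(2)[of s] mem(2)[of t] mem(4)[of s] mem(4)[of t]
        inj_on_eq_iff[OF h(2)[OF mem(1)[of 0]]] inj_on_eq_iff[OF h'(2)[OF mem(3)[of 0]]]
      by simp
  qed
qed

lemma group_mult_inj:
  assumes G: "comm_group G" and c: "carrier G = levels q"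
  shows "b \<in> levels q \<Longrightarrow> inj_on (\<lambda>a. mult G a b) (levels q)"
    "a \<in> levels q \<Longrightarrow> inj_on (mult G a) (levels q)"
proof -
  interpret comm_group G by fact
  show "b \<in> levels q \<Longrightarrow> inj_on (\<lambda>a. mult G a b) (levels q)"
    "a \<in> levels q \<Longrightarrow> inj_on (mult G a) (levels q)"
    using c by (auto simp: inj_on_def)
qed

section \<open>Combined columns as two-digit numbers\<close>

text \<open>The centring constants cancel: -r(q-1)/2 - (r-1)/2 + (qr-1)/2 = 0. What remains is the
  number with leading digit \<open>a\<close> and last digit \<open>b\<close> in base
  \<open>r\<close>.\<close>

lemma combined_column_kron:
  assumes "is_column m q f" "is_column n r g"
  shows "combined_column q f r g = kron (\<lambda>a b. real r * a + b) f g"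
proof (rule eq_matI)
  fix s t assume "s < dim_row (kron (\<lambda>a b. real r * a + b) f g)"
    "t < dim_col (kron (\<lambda>a b. real r * a + b) f g)"
  then have "s < m * n" and t: "t = 0"
    using columnD[OF assms(1)] columnD[OF assms(2)] by (simp_all add: kron_def)
  then obtain i j where ij: "i < m" "j < n" "s = i * n + j" by (elim pair_index)
  then show "combined_column q f r g $$ (s, t) = kron (\<lambda>a b. real r * a + b) f g $$ (s, t)"
    using columnD[OF assms(1)] columnD[OF assms(2)] pair_index_less[OF ij(1,2)]
    by (simp add: t combined_column_def scalar_add_def kron_sum_def kron_def field_simps)
qed (auto simp: combined_column_def scalar_add_def kron_sum_def kron_def)

text \<open>Uniqueness of quotient and remainder modulo \<open>r\<close>, after passing from reals
  to naturals.\<close>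

lemma real_pair_eq_iff:
  assumes "b < r" "b' < r"
  shows "real r * real a + real b = real r * real a' + real b' \<longleftrightarrow> a = a' \<and> b = b'"
proof
  assume "real r * real a + real b = real r * real a' + real b'"
  then have e: "r * a + b = r * a' + b'"
    by (metis of_nat_add of_nat_mult of_nat_eq_iff)
  then have "(r * a + b) div r = (r * a' + b') div r" "(r * a + b) mod r = (r * a' + b') mod r"
    by simp_all
  then show "a = a' \<and> b = b'" using assms by simp
qed simp

lemma pair_value_eq_iff:
  assumes "a \<in> levels q" "a' \<in> levels q" "b \<in> levels r" "b' \<in> levels r"
  shows "real r * a + b = real r * a' + b' \<longleftrightarrow> a = a' \<and> b = b'"
  using assms real_pair_eq_iff by (auto simp: levels_def)

lemma is_column_combined:
  assumes f: "is_column m q f" and g: "is_column n r g"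
  shows "is_column (m * n) (q * r) (combined_column q f r g)"
  unfolding is_column_def combined_column_kron[OF assms]
proof (intro conjI allI impI)
  show "kron (\<lambda>a b. real r * a + b) f g \<in> carrier_mat (m * n) 1"
    using columnD[OF f] columnD[OF g] by (simp add: kron_def)
  fix s assume "s < m * n"
  then obtain i j where ij: "i < m" "j < n" "s = i * n + j" by (elim pair_index)
  obtain a where a: "a < q" "f $$ (i, 0) = real a" using column_entry[OF f ij(1)] .
  obtain b where b: "b < r" "g $$ (j, 0) = real b" using column_entry[OF g ij(2)] .
  have "kron (\<lambda>a b. real r * a + b) f g $$ (s, 0) = real (a * r + b)"
    by (simp add: ij(3) index_kron_column[OF f g ij(1,2)] a b)
  \<comment> \<open>The bound for row indices is reused as a bound for levels.\<close>
  with pair_index_less[OF a(1) b(1)]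
  show "kron (\<lambda>a b. real r * a + b) f g $$ (s, 0) \<in> levels (q * r)"
    unfolding levels_def by (metis atLeastLessThan_iff image_eqI zero_le)
qed

text \<open>Every pair of digits is attained, since the rows for the two digits can be chosen
  independently.\<close>

lemma combined_column_onto:
  assumes f: "is_column m q f" and g: "is_column n r g"
    and fo: "(\<lambda>s. f $$ (s, 0)) ` {..<m} = levels q"
    and go: "(\<lambda>s. g $$ (s, 0)) ` {..<n} = levels r"
  shows "(\<lambda>s. combined_column q f r g $$ (s, 0)) ` {..<m * n} = levels (q * r)"
proof
  show "(\<lambda>s. combined_column q f r g $$ (s, 0)) ` {..<m * n} \<subseteq> levels (q * r)"
    using columnD(3)[OF is_column_combined[OF f g]] by auto
  show "levels (q * r) \<subseteq> (\<lambda>s. combined_column q f r g $$ (s, 0)) ` {..<m * n}"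
  proof
    fix x assume "x \<in> levels (q * r)"
    then obtain y where y: "y < q * r" "x = real y" by (auto simp: levels_def)
    obtain a b where ab: "a < q" "b < r" "y = a * r + b" using y(1) by (elim pair_index)
    have "real a \<in> levels q" "real b \<in> levels r" using ab by (auto simp: levels_def)
    then obtain i j where ij: "i < m" "f $$ (i, 0) = real a" "j < n" "g $$ (j, 0) = real b"
      by (metis (no_types, lifting) fo go imageE lessThan_iff)
    have "combined_column q f r g $$ (i * n + j, 0) = x"
      by (simp add: combined_column_kron[OF f g] index_kron_column[OF f g] ij y ab(3))
    then show "x \<in> (\<lambda>s. combined_column q f r g $$ (s, 0)) ` {..<m * n}"
      using pair_index_less[OF ij(1,3)] by (intro image_eqI[of _ _ "i * n + j"]) auto
  qed
qed

text \<open>A level equals the entry exactly if both digits agree, so the indicator factors into the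
  product of the indicators for the digits.\<close>

lemma induced_combined_column:
  assumes f: "is_column m q f" and g: "is_column n r g"
  shows "induced_mat (q * r) (combined_column q f r g) = induced_mat q f \<otimes>\<^sub>K induced_mat r g"
proof (rule eq_matI)
  note cf = columnD[OF f] and cg = columnD[OF g]
    and cc = columnD[OF is_column_combined[OF f g]]
  show "dim_row (induced_mat (q * r) (combined_column q f r g))
      = dim_row (induced_mat q f \<otimes>\<^sub>K induced_mat r g)"
    "dim_col (induced_mat (q * r) (combined_column q f r g))
      = dim_col (induced_mat q f \<otimes>\<^sub>K induced_mat r g)"
    using cf cg cc by (simp_all add: induced_mat_def kron_prod_def kron_def)
  fix s t assume "s < dim_row (induced_mat q f \<otimes>\<^sub>K induced_mat r g)"
    "t < dim_col (induced_mat q f \<otimes>\<^sub>K induced_mat r g)"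
  then have s: "s < m * n" and t: "t < q * r"
    using cf cg by (simp_all add: induced_mat_def kron_prod_def kron_def)
  obtain i j where ij: "i < m" "j < n" "s = i * n + j" using s by (elim pair_index)
  obtain u v where uv: "u < q" "v < r" "t = u * r + v" using t by (elim pair_index)
  have "real u \<in> levels q" "real v \<in> levels r" using uv by (auto simp: levels_def)
  from pair_value_eq_iff[OF cf(3)[OF ij(1)] this(1) cg(3)[OF ij(2)] this(2)]
  show "induced_mat (q * r) (combined_column q f r g) $$ (s, t)
      = (induced_mat q f \<otimes>\<^sub>K induced_mat r g) $$ (s, t)"
    using ij uv s t cf cg cc index_kron_column[OF f g ij(1,2)]
    by (simp add: induced_mat_def kron_prod_def kron_def combined_column_kron[OF f g] mult.commute)
qed

section \<open>Gram matrices of induced matrices\<close>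

text \<open>The rows of an induced matrix are unit vectors, and two of them have inner product 1 or
  0 according to whether they coincide.\<close>

lemma induced_gram:
  assumes f: "is_column n q f"
  shows "induced_mat q f * transpose_mat (induced_mat q f)
    = mat n n (\<lambda>(s, t). if f $$ (s, 0) = f $$ (t, 0) then 1 else 0)"
proof (rule eq_matI)
  fix s t assume "s < dim_row (mat n n (\<lambda>(s, t). if f $$ (s, 0) = f $$ (t, 0) then 1 else 0))"
    "t < dim_col (mat n n (\<lambda>(s, t). if f $$ (s, 0) = f $$ (t, 0) then 1 else 0))"
  then have st: "s < n" "t < n" by auto
  obtain a b where ab: "a < q" "f $$ (s, 0) = real a" "b < q" "f $$ (t, 0) = real b"
    using column_entry[OF f st(1)] column_entry[OF f st(2)] by metis
  have "(induced_mat q f * transpose_mat (induced_mat q f)) $$ (s, t)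
      = (\<Sum>k = 0..<q. (if a = k then 1 else 0) * (if b = k then 1 else 0))"
    using st columnD[OF f] by (simp add: induced_mat_def scalar_prod_def ab)
  also have "\<dots> = (\<Sum>k = 0..<q. if k = a then (if b = a then 1 else 0) else 0)"
    by (intro sum.cong) auto
  also have "\<dots> = (if a = b then 1 else 0)"
    using ab by auto
  finally show "(induced_mat q f * transpose_mat (induced_mat q f)) $$ (s, t)
      = mat n n (\<lambda>(s, t). if f $$ (s, 0) = f $$ (t, 0) then 1 else 0) $$ (s, t)"
    using st ab by simp
qed (use columnD[OF f] in \<open>auto simp: induced_mat_def\<close>)

text \<open>The Gram matrix is the 0/1 matrix of the relation of having equal entries, hence it
  carries exactly the partition.\<close>

lemma induced_gram_eq_iff:
  assumes f: "is_column n q f" and g: "is_column n r g"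
  shows "induced_mat q f * transpose_mat (induced_mat q f)
      = induced_mat r g * transpose_mat (induced_mat r g) \<longleftrightarrow> same_partition n f g"
  unfolding induced_gram[OF f] induced_gram[OF g]
proof
  assume e: "mat n n (\<lambda>(s, t). if f $$ (s, 0) = f $$ (t, 0) then 1 else 0)
    = (mat n n (\<lambda>(s, t). if g $$ (s, 0) = g $$ (t, 0) then 1 else 0) :: real mat)"
  show "same_partition n f g" unfolding same_partition_def
  proof (intro allI impI)
    fix s t assume "s < n" "t < n"
    then show "f $$ (s, 0) = f $$ (t, 0) \<longleftrightarrow> g $$ (s, 0) = g $$ (t, 0)"
      using arg_cong[OF e, of "\<lambda>M. M $$ (s, t)"] by (simp split: if_splits)
  qed
qed (auto simp: same_partition_def intro!: eq_matI)

section \<open>Stacked blocks and the permutation matrices of the group\<close>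

lemma stack_rows_carrier:
  assumes "\<And>M. M \<in> set Ms \<Longrightarrow> M \<in> carrier_mat m c"
  shows "stack_rows c Ms \<in> carrier_mat (length Ms * m) c"
  using assms
proof (induction Ms)
  case (Cons M Ms)
  then show ?case
    using carrier_append_rows[of M m c "stack_rows c Ms" "length Ms * m"]
    by (simp add: stack_rows_def)
qed (simp add: stack_rows_def)

lemma index_stack_rows:
  assumes "\<And>M. M \<in> set Ms \<Longrightarrow> M \<in> carrier_mat m c"
    and "i < length Ms" "j < m" "t < c"
  shows "stack_rows c Ms $$ (i * m + j, t) = Ms ! i $$ (j, t)"
  using assms
proof (induction Ms arbitrary: i)
  case (Cons M Ms)
  have M: "M \<in> carrier_mat m c" and S: "stack_rows c Ms \<in> carrier_mat (length Ms * m) c"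
    using Cons.prems(1) stack_rows_carrier[of Ms m c] by auto
  have st: "stack_rows c (M # Ms) = M @\<^sub>r stack_rows c Ms" by (simp add: stack_rows_def)
  show ?case
  proof (cases i)
    case 0
    then show ?thesis using M S Cons.prems(3,4) unfolding st append_rows_def
      by auto
  next
    case (Suc k)
    then have k: "k < length Ms" using Cons.prems by simp
    have "k * m + j < length Ms * m" using pair_index_less[OF k Cons.prems(3)] .
    then have "(M @\<^sub>r stack_rows c Ms) $$ (m + (k * m + j), t) = stack_rows c Ms $$ (k * m + j, t)"
      using M S Cons.prems(4) by (simp add: append_rows_def)
    also have "\<dots> = Ms ! k $$ (j, t)"
      using Cons.IH[of k] Cons.prems k by simp
    finally show ?thesis by (simp add: st Suc add.assoc)
  qed
qed simp

text \<open>Replaces the definite description by explicit entries: row \<open>j\<close> is the unit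
  vector at the group sum of \<open>i\<close> and \<open>j\<close>.\<close>

lemma shift_mat_entries:
  assumes G: "comm_group G" "carrier G = levels q" and i: "i \<in> levels q"
  shows "shift_mat G q i = mat q q (\<lambda>(j, t). if real t = mult G i (real j) then 1 else 0)"
proof -
  have P: "permutation_mat q (shift_mat G q i) \<and>
      map_mat (mult G i) (level_row q) = level_row q * transpose_mat (shift_mat G q i)"
    unfolding shift_mat_def by (rule theI'[OF shift_mat_ex1[OF assms]])
  then obtain p where p: "p permutes {0..<q}"
    and S: "shift_mat G q i = mat q q (\<lambda>(i, j). if j = p i then 1 else 0)"
    by (auto simp: permutation_mat_def)
  have e: "map_mat (mult G i) (level_row q) = mat 1 q (\<lambda>(i, j). real (p j))"
    using P S level_row_mult_perm[OF p] by simp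
  \<comment> \<open>Position \<open>j\<close> of the equation for the level row identifies
    \<open>p j\<close> with the group sum.\<close>
  have "t = p j \<longleftrightarrow> real t = mult G i (real j)" if "j < q" for j t
    using arg_cong[OF e, of "\<lambda>M. M $$ (0, j)"] that by (simp add: level_row_def)
  then show ?thesis unfolding S by (intro eq_matI) simp_all
qed

text \<open>Row \<open>j\<close> of the induced matrix is the unit vector at the entry of
  \<open>g\<close>, so the product selects that row of the shift matrix. The product is thus the
  induced matrix of \<open>g\<close> translated by \<open>i\<close>.\<close>

lemma induced_mult_shift:
  assumes G: "comm_group G" "carrier G = levels q" and i: "i \<in> levels q"
    and g: "is_column n q g" and "j < n" "t < q"
  shows "(induced_mat q g * shift_mat G q i) $$ (j, t)
    = (if real t = mult G i (g $$ (j, 0)) then 1 else 0)"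
proof -
  obtain b where b: "b < q" "g $$ (j, 0) = real b" using column_entry[OF g \<open>j < n\<close>] .
  have "(induced_mat q g * shift_mat G q i) $$ (j, t)
      = (\<Sum>k = 0..<q. (if b = k then 1 else 0) * (if real t = mult G i (real k) then 1 else 0))"
    using assms(5,6) columnD[OF g]
    by (simp add: induced_mat_def scalar_prod_def b shift_mat_entries[OF G i])
  also have "\<dots> = (\<Sum>k = 0..<q. if k = b then (if real t = mult G i (real b) then 1 else 0) else 0)"
    by (intro sum.cong) auto
  finally show ?thesis using b by simp
qed

text \<open>Within one block of rows the entry of \<open>f\<close> is constant, so the block is the
  induced matrix of a translate of \<open>g\<close>.\<close>

lemma induced_group_kron_sum_stack:
  assumes G: "comm_group G" "carrier G = levels q"
    and f: "is_column m q f" and g: "is_column n q g"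
  shows "induced_mat q (group_kron_sum G f g)
    = stack_rows q (map (\<lambda>s. induced_mat q g * shift_mat G q (f $$ (s, 0))) [0..<m])"
    (is "?L = stack_rows q ?Ms")
proof (rule eq_matI)
  note cf = columnD[OF f] and cg = columnD[OF g]
  have c: "M \<in> carrier_mat n q" if "M \<in> set ?Ms" for M
    using that cf cg by (auto simp: induced_mat_def shift_mat_entries[OF G])
  have S: "stack_rows q ?Ms \<in> carrier_mat (m * n) q"
    using stack_rows_carrier[of ?Ms n q] c by simp
  then show "dim_row ?L = dim_row (stack_rows q ?Ms)" "dim_col ?L = dim_col (stack_rows q ?Ms)"
    using cf cg by (simp_all add: induced_mat_def group_kron_sum_def kron_def)
  fix s t assume "s < dim_row (stack_rows q ?Ms)" "t < dim_col (stack_rows q ?Ms)"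
  then have s: "s < m * n" and t: "t < q" using S by auto
  obtain i j where ij: "i < m" "j < n" "s = i * n + j" using s by (elim pair_index)
  have "stack_rows q ?Ms $$ (s, t) = ?Ms ! i $$ (j, t)"
    unfolding ij(3) by (rule index_stack_rows[OF c _ ij(2) t]) (simp_all add: ij)
  also have "\<dots> = (if real t = mult G (f $$ (i, 0)) (g $$ (j, 0)) then 1 else 0)"
    using ij by (simp add: induced_mult_shift[OF G cf(3)[OF ij(1)] g ij(2) t])
  also have "\<dots> = ?L $$ (s, t)"
    using index_kron_column[OF f g ij(1,2)] s t ij cf cg
    by (auto simp: induced_mat_def group_kron_sum_def kron_def)
  finally show "?L $$ (s, t) = stack_rows q ?Ms $$ (s, t)" by simp
qed

text \<open>A row of the Kronecker product belonging to entries \<open>a\<close> and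
  \<open>b\<close> is the unit vector at \<open>a * q + b\<close>; multiplication therefore selects
  row \<open>b\<close> of the block for \<open>a\<close>, whose 1 stands at their group sum.\<close>

lemma induced_group_kron_sum_prod:
  assumes G: "comm_group G" "carrier G = levels q"
    and f: "is_column m q f" and g: "is_column n q g"
  shows "induced_mat q (group_kron_sum G f g)
    = (induced_mat q f \<otimes>\<^sub>K induced_mat q g)
        * stack_rows q (map (\<lambda>i. shift_mat G q (real i)) [0..<q])"
    (is "?L = ?K * stack_rows q ?Ms")
proof (rule eq_matI)
  note cf = columnD[OF f] and cg = columnD[OF g]
  have lev: "real a \<in> levels q" if "a < q" for a using that by (simp add: levels_def)
  have c: "M \<in> carrier_mat q q" if "M \<in> set ?Ms" for M
    using that lev by (auto simp: shift_mat_entries[OF G])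
  have S: "stack_rows q ?Ms \<in> carrier_mat (q * q) q"
    using stack_rows_carrier[of ?Ms q q] c by simp
  have K: "?K \<in> carrier_mat (m * n) (q * q)"
    using cf cg by (simp add: induced_mat_def kron_prod_def kron_def)
  show "dim_row ?L = dim_row (?K * stack_rows q ?Ms)" "dim_col ?L = dim_col (?K * stack_rows q ?Ms)"
    using S K cf cg by (simp_all add: induced_mat_def group_kron_sum_def kron_def)
  fix s t assume "s < dim_row (?K * stack_rows q ?Ms)" "t < dim_col (?K * stack_rows q ?Ms)"
  then have s: "s < m * n" and t: "t < q" using S K by auto
  obtain i j where ij: "i < m" "j < n" "s = i * n + j" using s by (elim pair_index)
  obtain a where a: "a < q" "f $$ (i, 0) = real a" using column_entry[OF f ij(1)] .
  obtain b where b: "b < q" "g $$ (j, 0) = real b" using column_entry[OF g ij(2)] .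
  have row: "?K $$ (s, u) = (if u = a * q + b then 1 else 0)" if u: "u < q * q" for u
  proof -
    obtain v w where vw: "v < q" "w < q" "u = v * q + w" using u by (elim pair_index)
    have "v * q + w = a * q + b \<longleftrightarrow> a = v \<and> b = w"
      using real_pair_eq_iff[OF b(1) vw(2), of a v]
      by (simp add: mult.commute[of q] flip: of_nat_mult of_nat_add) auto
    then show ?thesis using s u ij vw a b cf cg
      by (simp add: induced_mat_def kron_prod_def kron_def)
  qed
  have "(?K * stack_rows q ?Ms) $$ (s, t) = (\<Sum>u = 0..<q * q. ?K $$ (s, u) * stack_rows q ?Ms $$ (u, t))"
    using S K s t by (simp add: scalar_prod_def)
  also have "\<dots> = (\<Sum>u = 0..<q * q. if u = a * q + b then stack_rows q ?Ms $$ (u, t) else 0)"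
    by (intro sum.cong) (auto simp: row)
  also have "\<dots> = stack_rows q ?Ms $$ (a * q + b, t)"
    using pair_index_less[OF a(1) b(1)] by simp
  also have "\<dots> = ?Ms ! a $$ (b, t)"
    by (rule index_stack_rows[OF c _ b(1) t]) (simp_all add: a)
  also have "\<dots> = (if real t = mult G (real a) (real b) then 1 else 0)"
    using a b t by (simp add: shift_mat_entries[OF G lev])
  also have "\<dots> = ?L $$ (s, t)"
    using index_kron_column[OF f g ij(1,2)] s t ij cf cg a b
    by (auto simp: induced_mat_def group_kron_sum_def kron_def)
  finally show "?L $$ (s, t) = (?K * stack_rows q ?Ms) $$ (s, t)" by simp
qed

section \<open>Comparison of the constructed columns\<close>

text \<open>Entries of a combined column agree exactly if both digits agree, so its partition is
  determined by those of the factors. A group sum does not determine its summands in this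
  way.\<close>

lemma combined_same_partition:
  assumes f: "is_column m q f" and g: "is_column n r g"
    and f': "is_column m q f'" and g': "is_column n r g'"
    and kf: "same_partition m f f'" and kg: "same_partition n g g'"
  shows "same_partition (m * n) (combined_column q f r g) (combined_column q f' r g')"
  unfolding same_partition_def
proof (intro allI impI)
  fix s t assume st: "s < m * n" "t < m * n"
  obtain i j where ij: "i < m" "j < n" "s = i * n + j" using st(1) by (elim pair_index)
  obtain u v where uv: "u < m" "v < n" "t = u * n + v" using st(2) by (elim pair_index)
  note mem = columnD(3)[OF f] columnD(3)[OF g] columnD(3)[OF f'] columnD(3)[OF g']
  have "f $$ (i, 0) = f $$ (u, 0) \<longleftrightarrow> f' $$ (i, 0) = f' $$ (u, 0)"
    "g $$ (j, 0) = g $$ (v, 0) \<longleftrightarrow> g' $$ (j, 0) = g' $$ (v, 0)"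
    using kf kg ij uv by (auto simp: same_partition_def)
  then show "combined_column q f r g $$ (s, 0) = combined_column q f r g $$ (t, 0) \<longleftrightarrow>
      combined_column q f' r g' $$ (s, 0) = combined_column q f' r g' $$ (t, 0)"
    using ij uv
    by (simp add: combined_column_kron[OF f g] combined_column_kron[OF f' g']
        index_kron_column[OF f g] index_kron_column[OF f' g'] pair_value_eq_iff[of _ q] mem)
qed

theorem theorem1:
  fixes n q :: "nat \<Rightarrow> nat" and f X :: "nat \<Rightarrow> real mat"
  assumes "\<And>j. j \<in> {1..4} \<Longrightarrow> n j \<ge> 1"
    and "\<And>j. j \<in> {1..4} \<Longrightarrow> q j \<ge> 2"
    and "\<And>j. j \<in> {1..4} \<Longrightarrow> is_column (n j) (q j) (f j)"
    and "\<And>j. j \<in> {1..4} \<Longrightarrow> balanced (q j) (f j)"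
    and "\<And>j. j \<in> {1..4} \<Longrightarrow> X j = induced_mat (q j) (f j)"
    and "n 1 = n 3" and "n 2 = n 4"
  shows
    "(\<forall>(k::nat) (G::real monoid).
        q 1 = k \<and> q 2 = k \<and> q 3 = k \<and> q 4 = k \<and> comm_group G \<and> carrier G = levels k \<longrightarrow>
        (fully_aliased k (f 1) k (f 3) \<longleftrightarrow>
           X 1 * transpose_mat (X 1) = X 3 * transpose_mat (X 3)) \<and>
        (induced_mat k (group_kron_sum G (f 1) (f 2)) =
           stack_rows k (map (\<lambda>s. X 2 * shift_mat G k (f 1 $$ (s, 0))) [0..<n 1]) \<and>
         stack_rows k (map (\<lambda>s. X 2 * shift_mat G k (f 1 $$ (s, 0))) [0..<n 1]) =
           (X 1 \<otimes>\<^sub>K X 2) * stack_rows k (map (\<lambda>i. shift_mat G k (real i)) [0..<k])) \<and>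
        (fully_aliased k (group_kron_sum G (f 1) (f 2)) k (group_kron_sum G (f 3) (f 4)) \<longrightarrow>
           fully_aliased k (f 1) k (f 3) \<and> fully_aliased k (f 2) k (f 4))) \<and>
     (is_column (n 1 * n 2) (q 1 * q 2) (combined_column (q 1) (f 1) (q 2) (f 2)) \<and>
      induced_mat (q 1 * q 2) (combined_column (q 1) (f 1) (q 2) (f 2)) = X 1 \<otimes>\<^sub>K X 2) \<and>
     (fully_aliased (q 1 * q 2) (combined_column (q 1) (f 1) (q 2) (f 2))
                    (q 3 * q 4) (combined_column (q 3) (f 3) (q 4) (f 4)) \<longleftrightarrow>
        fully_aliased (q 1) (f 1) (q 3) (f 3) \<and> fully_aliased (q 2) (f 2) (q 4) (f 4)) \<and>
     (\<forall>(k::nat) (G::real monoid).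
        q 3 = k \<and> q 4 = k \<and> comm_group G \<and> carrier G = levels k \<longrightarrow>
        \<not> fully_aliased (q 1 * q 2) (combined_column (q 1) (f 1) (q 2) (f 2))
                        k (group_kron_sum G (f 3) (f 4)))"
proof -
  note pos = assms(1) and two = assms(2) and col = assms(3) and X = assms(5)
  have onto: "(\<lambda>s. f j $$ (s, 0)) ` {..<n j} = levels (q j)" if "j \<in> {1..4}" for j
    using balanced_onto[OF col[OF that] assms(4)[OF that] pos[OF that]] .
  \<comment> \<open>Columns 3 and 4 are restated with the lengths of columns 1 and 2, so that their
    rows can be compared.\<close>
  have c1: "is_column (n 1) (q 1) (f 1)" and c2: "is_column (n 2) (q 2) (f 2)"
    and c3: "is_column (n 1) (q 3) (f 3)" and c4: "is_column (n 2) (q 4) (f 4)"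
    using col[of 1] col[of 2] col[of 3] col[of 4] assms(6,7) by simp_all
  have o1: "(\<lambda>s. f 1 $$ (s, 0)) ` {..<n 1} = levels (q 1)"
    and o2: "(\<lambda>s. f 2 $$ (s, 0)) ` {..<n 2} = levels (q 2)"
    and o3: "(\<lambda>s. f 3 $$ (s, 0)) ` {..<n 1} = levels (q 3)"
    and o4: "(\<lambda>s. f 4 $$ (s, 0)) ` {..<n 2} = levels (q 4)"
    using onto[of 1] onto[of 2] onto[of 3] onto[of 4] assms(6,7) by simp_all
  have n1: "n 1 \<ge> 1" and n2: "n 2 \<ge> 1" using pos[of 1] pos[of 2] by simp_all
  have X1: "X 1 = induced_mat (q 1) (f 1)" and X2: "X 2 = induced_mat (q 2) (f 2)"
    and X3: "X 3 = induced_mat (q 3) (f 3)"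
    using X[of 1] X[of 2] X[of 3] by simp_all
  have q1: "q 1 \<ge> 2" using two[of 1] by simp
  \<comment> \<open>Cancellation for the two-digit operation. Membership of \<open>b\<close> in
    \<open>levels r\<close> forces \<open>r\<close> to be positive, so that the leading digit can be
    cancelled.\<close>
  have inj: "b \<in> levels r \<Longrightarrow> inj_on (\<lambda>a. real r * a + b) (levels p)"
    "inj_on (\<lambda>b. real r * a + b) (levels r)" for a b p r
    by (meson inj_onI pair_value_eq_iff) simp
  note cc = is_column_combined[OF c1 c2]
  have a: "(fully_aliased k (f 1) k (f 3) \<longleftrightarrow>
           X 1 * transpose_mat (X 1) = X 3 * transpose_mat (X 3)) \<and>
        (induced_mat k (group_kron_sum G (f 1) (f 2)) =
           stack_rows k (map (\<lambda>s. X 2 * shift_mat G k (f 1 $$ (s, 0))) [0..<n 1]) \<and>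
         stack_rows k (map (\<lambda>s. X 2 * shift_mat G k (f 1 $$ (s, 0))) [0..<n 1]) =
           (X 1 \<otimes>\<^sub>K X 2) * stack_rows k (map (\<lambda>i. shift_mat G k (real i)) [0..<k])) \<and>
        (fully_aliased k (group_kron_sum G (f 1) (f 2)) k (group_kron_sum G (f 3) (f 4)) \<longrightarrow>
           fully_aliased k (f 1) k (f 3) \<and> fully_aliased k (f 2) k (f 4))"
    if H: "q 1 = k \<and> q 2 = k \<and> q 3 = k \<and> q 4 = k \<and> comm_group G \<and> carrier G = levels k"
    for k and G :: "real monoid"
  proof -
    have qs: "q 1 = k" "q 2 = k" "q 3 = k" "q 4 = k" and G: "comm_group G" "carrier G = levels k"
      using H by auto
    note c = c1[unfolded qs] c2[unfolded qs] c3[unfolded qs] c4[unfolded qs]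
      and o = o1[unfolded qs] o2[unfolded qs]
    \<comment> \<open>Both sides say that the two columns induce the same partition.\<close>
    have 1: "fully_aliased k (f 1) k (f 3) \<longleftrightarrow>
        X 1 * transpose_mat (X 1) = X 3 * transpose_mat (X 3)"
      unfolding X1 X3 qs induced_gram_eq_iff[OF c(1,3)]
      using fully_aliased_same_partition[OF c(1)] same_partition_fully_aliased[OF c(1) o(1) c(3)]
      by blast
    have 3: "fully_aliased k (f 1) k (f 3) \<and> fully_aliased k (f 2) k (f 4)"
      if fa: "fully_aliased k (group_kron_sum G (f 1) (f 2)) k (group_kron_sum G (f 3) (f 4))"
    proof -
      have "same_partition (n 1 * n 2) (group_kron_sum G (f 1) (f 2)) (group_kron_sum G (f 3) (f 4))"
        using fully_aliased_same_partition[OF is_column_group_kron_sum[OF G c(1,2)] fa] .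
      note kron_same_partition_factors[OF c n1 n2 this[unfolded group_kron_sum_def]
          group_mult_inj[OF G] group_mult_inj[OF G]]
      then show ?thesis
        using same_partition_fully_aliased[OF c(1) o(1) c(3)]
          same_partition_fully_aliased[OF c(2) o(2) c(4)] by blast
    qed
    note Xk = X1[unfolded qs] X2[unfolded qs]
    show ?thesis
      using 1 3 induced_group_kron_sum_stack[OF G c(1,2), folded Xk]
        induced_group_kron_sum_prod[OF G c(1,2), folded Xk] by simp
  qed
  have b: "fully_aliased (q 1 * q 2) (combined_column (q 1) (f 1) (q 2) (f 2))
                    (q 3 * q 4) (combined_column (q 3) (f 3) (q 4) (f 4)) \<longleftrightarrow>
        fully_aliased (q 1) (f 1) (q 3) (f 3) \<and> fully_aliased (q 2) (f 2) (q 4) (f 4)"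
  proof
    assume "fully_aliased (q 1 * q 2) (combined_column (q 1) (f 1) (q 2) (f 2))
        (q 3 * q 4) (combined_column (q 3) (f 3) (q 4) (f 4))"
    from fully_aliased_same_partition[OF cc this]
    have k: "same_partition (n 1) (f 1) (f 3)" "same_partition (n 2) (f 2) (f 4)"
      using kron_same_partition_factors[OF c1 c2 c3 c4 n1 n2 _ inj inj]
      unfolding combined_column_kron[OF c1 c2] combined_column_kron[OF c3 c4] by blast+
    \<comment> \<open>The assumption equates only the products of the numbers of levels; the
      separate equalities come from counting parts.\<close>
    have "q 3 = q 1" "q 4 = q 2"
      using same_partition_levels_eq[OF c1 o1 c3 o3 k(1)] same_partition_levels_eq[OF c2 o2 c4 o4 k(2)]
      by simp_all
    then show "fully_aliased (q 1) (f 1) (q 3) (f 3) \<and> fully_aliased (q 2) (f 2) (q 4) (f 4)"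
      using same_partition_fully_aliased[OF c1 o1] same_partition_fully_aliased[OF c2 o2] c3 c4 k
      by simp
  next
    assume fa: "fully_aliased (q 1) (f 1) (q 3) (f 3) \<and> fully_aliased (q 2) (f 2) (q 4) (f 4)"
    then have e: "q 3 = q 1" "q 4 = q 2" by (simp_all add: fully_aliased_def)
    have k: "same_partition (n 1) (f 1) (f 3)" "same_partition (n 2) (f 2) (f 4)"
      using fa fully_aliased_same_partition[OF c1] fully_aliased_same_partition[OF c2] by blast+
    show "fully_aliased (q 1 * q 2) (combined_column (q 1) (f 1) (q 2) (f 2))
        (q 3 * q 4) (combined_column (q 3) (f 3) (q 4) (f 4))"
      \<comment> \<open>With equal numbers of levels, the agreeing partitions of the combined
        columns yield a permutation of their levels.\<close>
      unfolding e
      using same_partition_fully_aliased[OF cc combined_column_onto[OF c1 c2 o1 o2]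
          is_column_combined[OF c3[unfolded e] c4[unfolded e]]
          combined_same_partition[OF c1 c2 c3[unfolded e] c4[unfolded e] k]] .
  qed
  have c: "\<not> fully_aliased (q 1 * q 2) (combined_column (q 1) (f 1) (q 2) (f 2))
                        k (group_kron_sum G (f 3) (f 4))"
    if H: "q 3 = k \<and> q 4 = k \<and> comm_group G \<and> carrier G = levels k" for k and G :: "real monoid"
  proof
    assume fa: "fully_aliased (q 1 * q 2) (combined_column (q 1) (f 1) (q 2) (f 2))
        k (group_kron_sum G (f 3) (f 4))"
    have qs: "q 3 = k" "q 4 = k" and G: "comm_group G" "carrier G = levels k" using H by auto
    from fully_aliased_same_partition[OF cc fa]
    have k: "same_partition (n 1) (f 1) (f 3)" "same_partition (n 2) (f 2) (f 4)"
      \<comment> \<open>Here the two operations differ: two-digit numbers on one side, the group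
        operation on the other.\<close>
      using kron_same_partition_factors[OF c1 c2 c3[unfolded qs] c4[unfolded qs] n1 n2 _ inj
          group_mult_inj[OF G]]
      unfolding combined_column_kron[OF c1 c2] group_kron_sum_def by blast+
    have "q 1 = k" "q 2 = k"
      using same_partition_levels_eq[OF c1 o1 c3 o3 k(1)] same_partition_levels_eq[OF c2 o2 c4 o4 k(2)]
        qs by simp_all
    \<comment> \<open>Full aliasing includes equal numbers of levels, so \<open>k * k = k\<close>,
      against \<open>q 1 \<ge> 2\<close>.\<close>
    moreover have "q 1 * q 2 = k" using fa by (simp add: fully_aliased_def)
    ultimately show False using q1 by simp
  qed
  show ?thesis
    using a b c cc induced_combined_column[OF c1 c2] unfolding X1 X2 by blast
qed

end
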